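(* There exists a positive semidefinite polynomial $f\in\mathbb{R}[x,y,z]$ that is a sum of squares in $\mathbb{R}[[x,y,z]]$ and in $\mathbb{R}[x,y,z]_{\mathfrak{p}}$ for all prime ideals $\mathfrak{p}\subset\mathbb{R}[x,y,z]$ distinct from $\langle x,y,z\rangle$, but that is not a sum of squares in $\mathbb{R}[x,y,z]_{\langle x,y,z\rangle}$.
   Context: A polynomial $f\in\mathbb{R}[x,y,z]$ is positive semidefinite if $f(a)\geq 0$ for all $a\in\mathbb{R}^3$. For a prime ideal $\mathfrak{p}$, $\mathbb{R}[x,y,z]_{\mathfrak{p}}$ denotes the localization at $\mathfrak{p}$. Sums of squares are finite. *)

theory Defs
  imports
    "HOL-Algebra.Algebraic_Closure_Type"
    "HOL-Computational_Algebra.Computational_Algebra"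
begin

(* R[x,y,z] is R[x][y][z]: z is the outermost and x the innermost variable. *)
type_synonym poly3 = "real Polynomial.poly Polynomial.poly Polynomial.poly"

(* R[[x,y,z]] is R[[x]][[y]][[z]], with the same order of variables. *)
type_synonym fps3 = "real fps fps fps"

definition var_x :: poly3 where "var_x = [:[:[:0, 1:]:]:]"
definition var_y :: poly3 where "var_y = [:[:0, 1:]:]"
definition var_z :: poly3 where "var_z = [:0, 1:]"

definition eval3 :: "poly3 \<Rightarrow> real \<Rightarrow> real \<Rightarrow> real \<Rightarrow> real" where
  "eval3 f a b c = Polynomial.poly (Polynomial.poly (Polynomial.poly f [:[:c:]:]) [:b:]) a"

lemma eval3_var [simp]:
  "eval3 var_x a b c = a" "eval3 var_y a b c = b" "eval3 var_z a b c = c"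
  by (simp_all add: eval3_def var_x_def var_y_def var_z_def)

definition positive_semidefinite :: "poly3 \<Rightarrow> bool" where
  "positive_semidefinite f \<longleftrightarrow> (\<forall>a b c. eval3 f a b c \<ge> 0)"

definition fps3_of_poly3 :: "poly3 \<Rightarrow> fps3" where
  "fps3_of_poly3 f = fps_of_poly (map_poly (\<lambda>g. fps_of_poly (map_poly fps_of_poly g)) f)"

lemma fps3_of_poly3_nth:
  "fps_nth (fps_nth (fps_nth (fps3_of_poly3 f) k) j) i =
     Polynomial.coeff (Polynomial.coeff (Polynomial.coeff f k) j) i"
  by (simp add: fps3_of_poly3_def coeff_map_poly)

definition poly3_ring :: "poly3 ring" where
  "poly3_ring = ring_of_type_algebra"

definition origin_ideal :: "poly3 set" where
  "origin_ideal = Idl\<^bsub>poly3_ring\<^esub> {var_x, var_y, var_z}"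

(* The localization of an integral domain at a prime ideal P, as a subring of the
   field of fractions; an element f of the domain appears there as Fract f 1. *)
definition localization :: "'a::idom set \<Rightarrow> 'a fract set" where
  "localization P = {Fraction_Field.Fract g h | g h. h \<notin> P}"

(* A is the carrier of a subring; the squared elements must lie in A. *)
definition sum_of_squares_in :: "'a::comm_ring_1 set \<Rightarrow> 'a \<Rightarrow> bool" where
  "sum_of_squares_in A a \<longleftrightarrow> (\<exists>gs. set gs \<subseteq> A \<and> a = (\<Sum>g\<leftarrow>gs. g ^ 2))"

end

theory Submission
  imports Defs
begin

text \<open>
  Write \<open>w = 1 - z\<close> and adjoin a square root \<open>s\<close> of \<open>-w\<close>. The witness is the norm
  \<open>f = p\<^sub>s p\<^sub>-\<^sub>s\<close> from \<open>\<real>[x,y,z][s]\<close> to \<open>\<real>[x,y,z]\<close> of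
  \<open>p\<^sub>s = E (x + s y)\<^sup>2 + s\<^sup>6 y\<^sup>4\<close>, where \<open>E = z\<^sup>2 - 4 w y\<^sup>2 = z\<^sup>2 + 4 s\<^sup>2 y\<^sup>2\<close>.
  Writing \<open>p\<^sub>s = a + s b\<close> gives \<open>f = a\<^sup>2 + w b\<^sup>2\<close>. Where \<open>w \<ge> 0\<close> this shows that \<open>f \<ge> 0\<close>;
  where \<open>w < 0\<close>, the number \<open>s\<close> is real and both factors are nonnegative. Near the origin \<open>w\<close> is
  the square of a power series, so \<open>f\<close> is a sum of two squares in \<open>\<real>[[x,y,z]]\<close>. But \<open>w\<close>
  becomes negative on the line \<open>x = y = 0\<close>, and this is what the local ring at the origin sees.

  Away from the origin: \<open>p\<^sub>s\<close> is the squared length of the vector \<open>\<alpha> + s \<beta>\<close> with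
  \<open>\<alpha> = (z x, -2 w y\<^sup>2, 0)\<close> and \<open>\<beta> = (z y, 2 x y, w y\<^sup>2)\<close>. For every vector \<open>\<gamma>\<close> and scalar
  \<open>\<delta>\<close> with \<open>\<gamma> \<cdot> (\<alpha> \<times> \<beta>) = \<delta> (\<alpha> \<cdot> \<beta>)\<close>, the product of \<open>f\<close> with the sum of squares
  \<open>h = \<bar>\<gamma>\<bar>\<^sup>2 + \<delta>\<^sup>2\<close> is again a sum of squares (\<open>multiplier_identity\<close>). If \<open>h\<close> lies outside the
  prime \<open>P\<close>, then \<open>f = h (h f) / h\<^sup>2\<close> is a sum of squares in the localization at \<open>P\<close>. Five pairs
  \<open>(\<gamma>, \<delta>)\<close> suffice: a prime that contains all five multipliers contains \<open>x\<close>, \<open>y\<close> and \<open>z\<close>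
  (\<open>bad_poly_sos_localization\<close>).

  At the origin: let \<open>h\<^sup>2 f = \<Sum> g\<^sub>i\<^sup>2\<close> with \<open>h(0) \<noteq> 0\<close>. Each \<open>g = g\<^sub>i\<close> satisfies
  \<open>g\<^sup>2 \<le> h\<^sup>2 f\<close> on \<open>\<real>\<^sup>3\<close>, so it vanishes wherever and as fast as \<open>f\<close> forces it to. Since \<open>f\<close>
  vanishes to order 8 at the origin, \<open>g\<close> starts with a quartic form. Along the axis at height \<open>z > 1\<close>,
  the lowest form of \<open>f\<close> in \<open>x, y\<close> is the square of the indefinite form \<open>z\<^sup>2 (x\<^sup>2 + w y\<^sup>2)\<close>; hence
  the quadratic part of \<open>g\<close> in \<open>x, y\<close> is a multiple of \<open>x\<^sup>2 + w y\<^sup>2\<close>. This is a polynomial identity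
  in \<open>z\<close>. Since \<open>w = 1\<close> at \<open>z = 0\<close> and \<open>g\<close> has no cubic part, comparing coefficients at \<open>z\<^sup>2\<close> shows
  that \<open>x\<^sup>2 z\<^sup>2\<close> and \<open>y\<^sup>2 z\<^sup>2\<close> have the same coefficient \<open>\<lambda>\<close> in the quartic form of \<open>g\<close> (\<open>coeffs_along_axis\<close>). On the other hand, zeros of the
  leading form of \<open>f\<close> make these two coefficients opposite (\<open>line3_diagonal_zero\<close>). Thus
  \<open>\<lambda> = 0\<close> for every \<open>g\<^sub>i\<close>, so that \<open>\<Sum> g\<^sub>i\<^sup>2\<close> vanishes to order 10 along the line
  \<open>(t, 0, t)\<close>, whereas \<open>h\<^sup>2 f\<close> vanishes there only to order 8.
\<close>

section \<open>The polynomial\<close>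

text \<open>
  Keeping \<open>w\<close> as a separate argument makes the form homogeneous of degree 8 in \<open>x, y, z\<close>, and
  \<open>w = 1\<close> gives the leading form of \<open>bad_poly\<close> at the origin.
\<close>
definition bad_form :: "'a::comm_ring_1 \<Rightarrow> 'a \<Rightarrow> 'a \<Rightarrow> 'a \<Rightarrow> 'a" where
  "bad_form x y z w =
     ((z^2 - 4*w*y^2) * (x^2 - w*y^2) - w^3*y^4)^2 + w * (2*(z^2 - 4*w*y^2)*x*y)^2"

definition bad_poly :: poly3 where
  "bad_poly = bad_form var_x var_y var_z (1 - var_z)"

lemma eval3_arith [simp]:
  "eval3 (f + g) a b c = eval3 f a b c + eval3 g a b c"
  "eval3 (f - g) a b c = eval3 f a b c - eval3 g a b c"
  "eval3 (f * g) a b c = eval3 f a b c * eval3 g a b c"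
  "eval3 (f ^ n) a b c = eval3 f a b c ^ n"
  "eval3 0 a b c = 0" "eval3 1 a b c = 1" "eval3 (numeral k) a b c = numeral k"
  by (simp_all add: eval3_def)

lemma poly_bad_form:
  "Polynomial.poly (bad_form p q r w) t =
    bad_form (Polynomial.poly p t) (Polynomial.poly q t) (Polynomial.poly r t) (Polynomial.poly w t)"
  by (simp add: bad_form_def)

lemma eval3_bad_poly: "eval3 bad_poly a b c = bad_form a b c (1 - c)"
  by (simp add: bad_poly_def bad_form_def)

lemma bad_form_homogeneous:
  fixes x y z w t :: "'a::comm_ring_1"
  shows "bad_form (t*x) (t*y) (t*z) w = t^8 * bad_form x y z w"
  unfolding bad_form_def by (simp add: algebra_simps eval_nat_numeral)

text \<open>The factorization as a norm, available as soon as \<open>-w\<close> is a square.\<close>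

lemma bad_form_conjugates:
  fixes x y z s :: "'a::comm_ring_1"
  shows "bad_form x y z (-(s^2)) =
     ((z^2 + 4*s^2*y^2) * (x + s*y)^2 + s^6*y^4) * ((z^2 + 4*s^2*y^2) * (x - s*y)^2 + s^6*y^4)"
  unfolding bad_form_def by (simp add: algebra_simps eval_nat_numeral)

lemma bad_form_nonneg: "bad_form x y z w \<ge> (0::real)"
proof (cases "w \<ge> 0")
  case True
  then show ?thesis by (simp add: bad_form_def)
next
  case False
  then have w: "w = -(sqrt (-w)^2)"
    by simp
  have "bad_form x y z (-(sqrt (-w)^2)) \<ge> 0"
    unfolding bad_form_conjugates
    by (intro mult_nonneg_nonneg add_nonneg_nonneg) (auto simp: False)
  then show ?thesis
    using w by simp
qed

section \<open>Power series\<close>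

lemma fps3_of_poly3_arith:
  "fps3_of_poly3 (f + g) = fps3_of_poly3 f + fps3_of_poly3 g"
  "fps3_of_poly3 (f * g) = fps3_of_poly3 f * fps3_of_poly3 g"
  by (simp_all add: fps_eq_iff fps3_of_poly3_nth coeff_mult fps_mult_nth coeff_sum
      fps_sum_nth atLeast0AtMost)

text \<open>
  The coefficients of \<open>fps3\<close> in \<open>z\<close> do not form a field, so the root is taken among real power
  series and its coefficients are then embedded as constants.
\<close>

lemma ex_sqrt_one_minus_z: "\<exists>r. r^2 = fps3_of_poly3 (1 - var_z)"
proof -
  define s :: "real fps" where "s = fps_radical (\<lambda>_ _. 1) 2 (1 - fps_X)"
  have s: "s^2 = 1 - fps_X"
    using power_radical[of "1 - fps_X :: real fps" "\<lambda>_ _. 1" 1]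
    by (simp add: s_def numeral_2_eq_2)
  define r :: fps3 where "r = Abs_fps (\<lambda>n. fps_const (fps_const (fps_nth s n)))"
  have "r^2 = Abs_fps (\<lambda>n. fps_const (fps_const (fps_nth (s^2) n)))"
    by (simp add: r_def fps_eq_iff power2_eq_square fps_mult_nth fps_sum_nth)
  also have "\<dots> = fps3_of_poly3 (1 - var_z)"
    unfolding s
    by (auto simp: fps_eq_iff fps3_of_poly3_nth var_z_def coeff_pCons split: nat.splits)
  finally show ?thesis by blast
qed

lemma bad_poly_sos_power_series: "sum_of_squares_in UNIV (fps3_of_poly3 bad_poly)"
proof -
  obtain r where r: "r^2 = fps3_of_poly3 (1 - var_z)"
    using ex_sqrt_one_minus_z by blast
  obtain p q where pq: "bad_poly = p * p + (1 - var_z) * (q * q)"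
    unfolding bad_poly_def bad_form_def power2_eq_square by blast
  have "fps3_of_poly3 bad_poly = (\<Sum>g\<leftarrow>[fps3_of_poly3 p, r * fps3_of_poly3 q]. g^2)"
    unfolding pq by (simp add: fps3_of_poly3_arith r[symmetric] power2_eq_square mult_ac)
  then show ?thesis
    unfolding sum_of_squares_in_def by blast
qed

section \<open>Sums of squares in localizations\<close>

lemma sum_list_Fract_squares:
  assumes "h \<noteq> (0 :: 'a::idom)"
  shows "(\<Sum>g\<leftarrow>gs. Fraction_Field.Fract g h ^ 2) = Fraction_Field.Fract (\<Sum>g\<leftarrow>gs. g^2) (h^2)"
  using assms
  by (induction gs) (auto simp: power2_eq_square Zero_fract_def eq_fract algebra_simps)

lemma ex_product_of_sums_of_squares:
  "\<exists>ws. (\<Sum>u\<leftarrow>us. u^2) * (\<Sum>v\<leftarrow>vs. v^2) = (\<Sum>t\<leftarrow>ws. t^2 :: 'a::comm_ring_1)"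
proof
  show "(\<Sum>u\<leftarrow>us. u^2) * (\<Sum>v\<leftarrow>vs. v^2) = (\<Sum>t\<leftarrow>concat (map (\<lambda>u. map (\<lambda>v. u*v) vs) us). t^2)"
  proof (induction us)
    case (Cons u us)
    have "(\<Sum>t\<leftarrow>map (\<lambda>v. u * v) vs. t^2) = u^2 * (\<Sum>v\<leftarrow>vs. v^2)"
      by (simp add: o_def power_mult_distrib sum_list_const_mult)
    then show ?case
      using Cons by (simp add: distrib_right del: map_map)
  qed simp
qed

text \<open>
  If \<open>f h = v\<close> with \<open>h\<close> and \<open>v\<close> sums of squares, then \<open>f = h v / h\<^sup>2\<close>, and \<open>h v\<close> is a sum of
  squares.
\<close>

lemma sum_of_squares_in_localizationI:
  fixes f :: "'a::idom"
  assumes "(\<Sum>u\<leftarrow>us. u^2) \<notin> P" and "0 \<in> P"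
    and "f * (\<Sum>u\<leftarrow>us. u^2) = (\<Sum>v\<leftarrow>vs. v^2)"
  shows "sum_of_squares_in (localization P) (Fraction_Field.Fract f 1)"
proof -
  define h where "h = (\<Sum>u\<leftarrow>us. u^2)"
  have h: "h \<noteq> 0" "h \<notin> P"
    using assms by (auto simp: h_def)
  obtain ws where ws: "h * (\<Sum>v\<leftarrow>vs. v^2) = (\<Sum>t\<leftarrow>ws. t^2)"
    using ex_product_of_sums_of_squares unfolding h_def by blast
  have "f * h^2 = (\<Sum>t\<leftarrow>ws. t^2)"
    using assms(3) unfolding h_def[symmetric]
    by (simp add: ws[symmetric] power2_eq_square[of h] flip: mult.assoc)
  then have "Fraction_Field.Fract f 1 = (\<Sum>t\<leftarrow>ws. Fraction_Field.Fract t h ^ 2)"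
    using h by (simp add: sum_list_Fract_squares eq_fract)
  also have "\<dots> = (\<Sum>g\<leftarrow>map (\<lambda>t. Fraction_Field.Fract t h) ws. g^2)"
    by (simp add: o_def)
  finally show ?thesis
    using h unfolding sum_of_squares_in_def localization_def
    by (intro exI[of _ "map (\<lambda>t. Fraction_Field.Fract t h) ws"]) auto
qed

lemma sum_of_squares_in_localizationD:
  fixes f :: "'a::idom"
  assumes sos: "sum_of_squares_in (localization P) (Fraction_Field.Fract f 1)"
    and P: "0 \<in> P" "1 \<notin> P" "\<And>a b. a * b \<in> P \<Longrightarrow> a \<in> P \<or> b \<in> P"
  obtains h gs where "h \<notin> P" and "h^2 * f = (\<Sum>g\<leftarrow>gs. g^2)"
proof -
  have "\<exists>h us. h \<notin> P \<and> (\<Sum>g\<leftarrow>gs. g^2) = Fraction_Field.Fract (\<Sum>u\<leftarrow>us. u^2) (h^2)"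
    if "set gs \<subseteq> localization P" for gs
    using that
  proof (induction gs)
    case Nil
    show ?case
      using P by (intro exI[of _ 1] exI[of _ "[]"]) (simp add: Zero_fract_def)
  next
    case (Cons g gs)
    obtain h us where IH: "h \<notin> P"
        "(\<Sum>g\<leftarrow>gs. g^2) = Fraction_Field.Fract (\<Sum>u\<leftarrow>us. u^2) (h^2)"
      using Cons by auto
    obtain a b where g: "g = Fraction_Field.Fract a b" "b \<notin> P"
      using Cons.prems by (auto simp: localization_def)
    have nz: "h \<noteq> 0" "b \<noteq> 0"
      using IH g P by auto
    have "(\<Sum>u\<leftarrow>(a * h) # map (\<lambda>u. b * u) us. u^2) = (a*h)^2 + b^2 * (\<Sum>u\<leftarrow>us. u^2)"
      by (simp add: o_def power_mult_distrib sum_list_const_mult)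
    moreover have "(\<Sum>g\<leftarrow>g # gs. g^2) =
        Fraction_Field.Fract ((a*h)^2 + b^2 * (\<Sum>u\<leftarrow>us. u^2)) ((b*h)^2)"
      unfolding list.map sum_list.Cons IH(2) g
      using nz by (simp add: power2_eq_square eq_fract algebra_simps)
    ultimately have "(\<Sum>g\<leftarrow>g # gs. g^2) =
        Fraction_Field.Fract (\<Sum>u\<leftarrow>(a * h) # map (\<lambda>u. b * u) us. u^2) ((b*h)^2)"
      by simp
    moreover have "b * h \<notin> P"
      using IH g P by blast
    ultimately show ?case by blast
  qed
  then obtain h us where h: "h \<notin> P"
      "Fraction_Field.Fract f 1 = Fraction_Field.Fract (\<Sum>u\<leftarrow>us. u^2) (h^2)"
    using sos unfolding sum_of_squares_in_def by metis
  then have "h^2 * f = (\<Sum>u\<leftarrow>us. u^2)"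
    using P by (cases "h = 0") (auto simp: eq_fract mult.commute)
  then show ?thesis
    using h that by blast
qed

section \<open>Prime ideals\<close>

lemma primeideal_poly3_ringD:
  assumes "primeideal P poly3_ring"
  shows "0 \<in> P" "1 \<notin> P" "\<And>a b. a \<in> P \<Longrightarrow> b \<in> P \<Longrightarrow> a + b \<in> P"
    "\<And>a r. a \<in> P \<Longrightarrow> r * a \<in> P" "\<And>a b. a * b \<in> P \<Longrightarrow> a \<in> P \<or> b \<in> P"
proof -
  interpret primeideal P poly3_ring by fact
  note [simp] = poly3_ring_def ring_of_type_algebra_def
  show "0 \<in> P" using additive_subgroup.zero_closed[OF additive_subgroup_axioms] by simp
  show "1 \<notin> P" using one_imp_carrier I_notcarr by auto
  show "a + b \<in> P" if "a \<in> P" "b \<in> P" for a b using additive_subgroup.a_closed[OF additive_subgroup_axioms that] by simp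
  show "r * a \<in> P" if "a \<in> P" for a r using I_l_closed[OF that, of r] by simp
  show "a \<in> P \<or> b \<in> P" if "a * b \<in> P" for a b using I_prime[of a b] that by simp
qed

lemma ring_poly3_ring: "ring poly3_ring"
  unfolding poly3_ring_def by (rule ring_from_type_algebra)

text \<open>Peeling off the constant coefficient in each of the three variables in turn.\<close>

lemma poly3_minus_constant:
  "\<exists>p q r. f = [:[:[:eval3 f 0 0 0:]:]:] + p * var_x + q * var_y + r * var_z"
proof -
  obtain f1 r where f: "f = pCons f1 r" by (cases f)
  obtain f2 q where f1: "f1 = pCons f2 q" by (cases f1)
  obtain c p where f2: "f2 = pCons c p" by (cases f2)
  have "f = [:[:[:c:]:]:] + [:[:p:]:] * var_x + [:q:] * var_y + r * var_z"
    by (simp add: f f1 f2 var_x_def var_y_def var_z_def)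
  moreover have c: "eval3 f 0 0 0 = c"
    by (simp add: f f1 f2 eval3_def)
  ultimately show ?thesis unfolding c by blast
qed

lemma origin_ideal_eq: "origin_ideal = {f. eval3 f 0 0 0 = 0}"
proof
  interpret ring poly3_ring by (rule ring_poly3_ring)
  note R = poly3_ring_def ring_of_type_algebra_def
  have "ideal {f. eval3 f 0 0 0 = 0} poly3_ring"
  proof (rule idealI[OF ring_poly3_ring])
    show "subgroup {f. eval3 f 0 0 0 = 0} (add_monoid poly3_ring)"
    proof (rule add.subgroupI)
      fix f assume f: "f \<in> {f. eval3 f 0 0 0 = 0}"
      have "\<ominus>\<^bsub>poly3_ring\<^esub> f = - f"
        by (rule minus_equality) (simp_all add: R)
      then show "\<ominus>\<^bsub>poly3_ring\<^esub> f \<in> {f. eval3 f 0 0 0 = 0}"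
        using f by (simp add: eval3_def)
    qed (auto simp: R intro: exI[of _ 0])
  qed (auto simp: R)
  then show "origin_ideal \<subseteq> {f. eval3 f 0 0 0 = 0}"
    unfolding origin_ideal_def by (rule genideal_minimal) simp
  interpret I: ideal origin_ideal poly3_ring
    unfolding origin_ideal_def by (rule genideal_ideal) (simp add: R)
  have "{var_x, var_y, var_z} \<subseteq> origin_ideal"
    unfolding origin_ideal_def by (rule genideal_self) (simp add: R)
  then have "p * var_x + q * var_y + r * var_z \<in> origin_ideal" for p q r
    using I.a_closed I.I_l_closed by (simp add: R)
  then show "{f. eval3 f 0 0 0 = 0} \<subseteq> origin_ideal"
    using poly3_minus_constant by (metis (mono_tags, lifting) add_0 mem_Collect_eq pCons_0_0 subsetI)
qed

text \<open>
  The origin ideal is maximal: an element of \<open>P\<close> with nonzero value at the origin would put a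
  nonzero constant into \<open>P\<close>.
\<close>

lemma prime_eq_origin_ideal:
  assumes P: "primeideal P poly3_ring" and xyz: "var_x \<in> P" "var_y \<in> P" "var_z \<in> P"
  shows "P = origin_ideal"
proof -
  note D = primeideal_poly3_ringD[OF P]
  have *: "p * var_x + q * var_y + r * var_z \<in> P" for p q r
    using xyz D by simp
  show ?thesis
    unfolding origin_ideal_eq
  proof (rule subset_antisym; rule subsetI)
    fix f assume f: "f \<in> P"
    obtain p q r where e: "f = [:[:[:eval3 f 0 0 0:]:]:] + p * var_x + q * var_y + r * var_z"
      using poly3_minus_constant by blast
    have "[:[:[:eval3 f 0 0 0:]:]:] = f + (-1) * (p * var_x + q * var_y + r * var_z)"
      by (subst e) simp
    then have c: "[:[:[:eval3 f 0 0 0:]:]:] \<in> P"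
      using D(3)[OF f D(4)[OF *]] by metis
    have "eval3 f 0 0 0 = 0"
    proof (rule ccontr)
      assume "eval3 f 0 0 0 \<noteq> 0"
      then have "[:[:[:1 / eval3 f 0 0 0:]:]:] * [:[:[:eval3 f 0 0 0:]:]:] = 1"
        by (simp add: one_pCons)
      then show False
        using D(2) D(4)[OF c] by metis
    qed
    then show "f \<in> {f. eval3 f 0 0 0 = 0}"
      by simp
  next
    fix f assume "f \<in> {f. eval3 f 0 0 0 = 0}"
    then show "f \<in> P"
      using poly3_minus_constant[of f] * by auto
  qed
qed

section \<open>Multipliers\<close>

text \<open>
  The squared triple product \<open>(\<gamma> \<cdot> (\<alpha> \<times> \<beta>))\<^sup>2\<close> is the Gram determinant of the three vectors.
\<close>

lemma gram_determinant:
  fixes a1 a2 a3 b1 b2 b3 g1 g2 g3 :: "'a::{idom,ring_char_0}"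
  defines "A \<equiv> a1^2 + a2^2 + a3^2" and "B \<equiv> b1^2 + b2^2 + b3^2" and "G \<equiv> g1^2 + g2^2 + g3^2"
    and "C \<equiv> a1*b1 + a2*b2 + a3*b3" and "S \<equiv> a1*g1 + a2*g2 + a3*g3"
    and "T \<equiv> b1*g1 + b2*g2 + b3*g3"
  shows "(g1*(a2*b3 - a3*b2) + g2*(a3*b1 - a1*b3) + g3*(a1*b2 - a2*b1))^2 =
    A*B*G - A*T^2 - B*S^2 - G*C^2 + 2*C*S*T"
  unfolding A_def B_def G_def C_def S_def T_def by Groebner_Basis.algebra

text \<open>
  In the notation above, with \<open>A = \<bar>\<alpha>\<bar>\<^sup>2\<close>, \<open>B = \<bar>\<beta>\<bar>\<^sup>2\<close> and \<open>C = \<alpha> \<cdot> \<beta>\<close>, the norm of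
  \<open>\<bar>\<alpha> + s \<beta>\<bar>\<^sup>2\<close> is \<open>N = (A - w B)\<^sup>2 + 4 w C\<^sup>2\<close>. In Hamilton's quaternions over the extended ring,
  the vector part of \<open>(\<alpha> + s \<beta>) \<gamma> (\<alpha> - s \<beta>)\<close> is
  \<open>V = (A + w B) \<gamma> - 2 (\<alpha> \<cdot> \<gamma>) \<alpha> - 2 w (\<beta> \<cdot> \<gamma>) \<beta>\<close>, free of \<open>s\<close>, and its scalar part is
  \<open>\<plusminus>2 s (\<gamma> \<cdot> (\<alpha> \<times> \<beta>))\<close>. Multiplicativity of the quaternion norm therefore gives
  \<open>N \<bar>\<gamma>\<bar>\<^sup>2 = \<bar>V\<bar>\<^sup>2 - 4 w (\<gamma> \<cdot> (\<alpha> \<times> \<beta>))\<^sup>2\<close>. The hypothesis makes the negative term cancel against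
  the term \<open>4 w C\<^sup>2 \<delta>\<^sup>2\<close> of \<open>N \<delta>\<^sup>2\<close>.
\<close>

lemma multiplier_identity:
  fixes a1 a2 a3 b1 b2 b3 g1 g2 g3 :: "'a::{idom,ring_char_0}"
  defines "A \<equiv> a1^2 + a2^2 + a3^2" and "B \<equiv> b1^2 + b2^2 + b3^2" and "G \<equiv> g1^2 + g2^2 + g3^2"
    and "C \<equiv> a1*b1 + a2*b2 + a3*b3" and "S \<equiv> a1*g1 + a2*g2 + a3*g3"
    and "T \<equiv> b1*g1 + b2*g2 + b3*g3"
  assumes "g1*(a2*b3 - a3*b2) + g2*(a3*b1 - a1*b3) + g3*(a1*b2 - a2*b1) = d * C"
  shows "((A - w*B)^2 + w*(2*C)^2) * (G + d^2) =
    ((A + w*B)*g1 - 2*S*a1 - 2*w*T*b1)^2 + ((A + w*B)*g2 - 2*S*a2 - 2*w*T*b2)^2 +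
    ((A + w*B)*g3 - 2*S*a3 - 2*w*T*b3)^2 + (d*(A - w*B))^2"
proof -
  let ?v = "\<lambda>g a b. (A + w*B)*g - 2*S*a - 2*w*T*b"
  have "(?v g1 a1 b1)^2 + (?v g2 a2 b2)^2 + (?v g3 a3 b3)^2 =
    (A + w*B)^2*G + 4*S^2*A + 4*w^2*T^2*B - 4*(A + w*B)*(S*S + w*T*T) + 8*w*S*T*C"
    unfolding G_def C_def S_def T_def A_def B_def by Groebner_Basis.algebra
  moreover have "(d*C)^2 = A*B*G - A*T^2 - B*S^2 - G*C^2 + 2*C*S*T"
    using gram_determinant[of g1 a2 b3 a3 b2 g2 b1 a1 g3] assms(7)
    unfolding G_def C_def S_def T_def A_def B_def by metis
  ultimately show ?thesis
    by Groebner_Basis.algebra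
qed

text \<open>
  The hypothesis is the relation \<open>\<gamma> \<cdot> (\<alpha> \<times> \<beta>) = \<delta> (\<alpha> \<cdot> \<beta>)\<close> for the vectors \<open>\<alpha>\<close> and \<open>\<beta>\<close> that
  belong to \<open>bad_form\<close>; here \<open>\<alpha> \<cdot> \<beta> = x y E\<close>.
\<close>

lemma bad_form_multiplier:
  fixes x y z w :: "'a::{idom,ring_char_0}"
  assumes "2*z*y*(x^2 + w*y^2)*g3 - z*w*x*y^2*g2 - 2*w^2*y^4*g1 = d * (x*y*(z^2 - 4*w*y^2))"
  shows "\<exists>v1 v2 v3 v4.
    bad_form x y z w * (g1^2 + g2^2 + g3^2 + d^2) = v1^2 + v2^2 + v3^2 + v4^2"
proof -
  define A where "A = (z*x)^2 + (-2*w*y^2)^2 + 0^2"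
  define B where "B = (z*y)^2 + (2*x*y)^2 + (w*y^2)^2"
  define C where "C = (z*x)*(z*y) + (-2*w*y^2)*(2*x*y) + 0*(w*y^2)"
  have "A - w*B = (z^2 - 4*w*y^2) * (x^2 - w*y^2) - w^3*y^4"
    unfolding A_def B_def by (simp add: algebra_simps eval_nat_numeral)
  moreover have "2*C = 2*(z^2 - 4*w*y^2)*x*y"
    unfolding C_def by (simp add: algebra_simps eval_nat_numeral)
  ultimately have "bad_form x y z w = (A - w*B)^2 + w*(2*C)^2"
    unfolding bad_form_def by (simp only:)
  moreover have "g1*((-2*w*y^2)*(w*y^2) - 0*(2*x*y)) + g2*(0*(z*y) - (z*x)*(w*y^2)) +
      g3*((z*x)*(2*x*y) - (-2*w*y^2)*(z*y)) = d * C"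
    using assms unfolding C_def by Groebner_Basis.algebra
  ultimately show ?thesis
    using multiplier_identity[of g1 "-2*w*y^2" "w*y^2" 0 "2*x*y" g2 "z*y" "z*x" g3 d w]
    unfolding A_def[symmetric] B_def[symmetric] C_def[symmetric] by metis
qed

text \<open>
  The five multipliers used belong to \<open>\<gamma> = \<alpha>\<close>, \<open>\<beta>\<close> and \<open>\<alpha> + \<beta>\<close> with \<open>\<delta> = 0\<close>, to
  \<open>(0, E, 0)\<close> with \<open>\<delta> = -z w y\<close>, and to \<open>(0, 2 (x\<^sup>2 + w y\<^sup>2), w x y)\<close> with \<open>\<delta> = 0\<close>. The first
  three put \<open>2 (\<alpha> \<cdot> \<beta>) = 2 x y E\<close> into a prime that contains them all, and the case distinction on
  its factors leaves only the origin.
\<close>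

lemma bad_poly_sos_localization:
  assumes P: "primeideal P poly3_ring" and "P \<noteq> origin_ideal"
  shows "sum_of_squares_in (localization P) (Fraction_Field.Fract bad_poly 1)"
proof (rule ccontr)
  assume not_sos: "\<not> ?thesis"
  note D = primeideal_poly3_ringD[OF P]
  define x y z w where "x = var_x" "y = var_y" "z = var_z" "w = 1 - var_z"
  define E where "E = z^2 - 4*w*y^2"
  have power: "a \<in> P" if "a ^ n \<in> P" for a n
    using that D(2,5) by (induction n) auto
  have diff: "a - r * b \<in> P" if "a \<in> P" "b \<in> P" for a b r
    using D(3)[OF that(1) D(4)[OF that(2), of "-r"]] by simp
  have two: "2 \<notin> P"
  proof
    assume "2 \<in> P"
    then have "[:[:[:1/2:]:]:] * 2 \<in> P" by (rule D(4))
    moreover have "[:[:[:1/2:]:]:] * (2::poly3) = 1"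
      by (simp add: numeral_poly one_pCons)
    ultimately show False using D(2) by simp
  qed
  have in_P: "g1^2 + g2^2 + g3^2 + d^2 \<in> P"
    if syz: "2*z*y*(x^2 + w*y^2)*g3 - z*w*x*y^2*g2 - 2*w^2*y^4*g1 = d * (x*y*(z^2 - 4*w*y^2))"
    for g1 g2 g3 d
  proof (rule ccontr)
    assume g: "g1^2 + g2^2 + g3^2 + d^2 \<notin> P"
    obtain v1 v2 v3 v4 where
      "bad_form x y z w * (g1^2 + g2^2 + g3^2 + d^2) = v1^2 + v2^2 + v3^2 + v4^2"
      using bad_form_multiplier[OF syz] by blast
    then have "bad_poly * (\<Sum>u\<leftarrow>[g1, g2, g3, d]. u^2) = (\<Sum>v\<leftarrow>[v1, v2, v3, v4]. v^2)"
      by (simp add: bad_poly_def x_y_z_w_def add.assoc)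
    then have "sum_of_squares_in (localization P) (Fraction_Field.Fract bad_poly 1)"
      using g D(1)
      by (intro sum_of_squares_in_localizationI[where us = "[g1, g2, g3, d]"
            and vs = "[v1, v2, v3, v4]"]) (simp_all add: add.assoc)
    then show False
      using not_sos by contradiction
  qed
  have A: "(z*x)^2 + (-2*w*y^2)^2 \<in> P"
    using in_P[of 0 "-2*w*y^2" "z*x" 0] by (simp add: algebra_simps eval_nat_numeral)
  have B: "(z*y)^2 + (2*x*y)^2 + (w*y^2)^2 \<in> P"
    using in_P[of "w*y^2" "2*x*y" "z*y" 0] by (simp add: algebra_simps eval_nat_numeral)
  have AB: "(z*x + z*y)^2 + (-2*w*y^2 + 2*x*y)^2 + (w*y^2)^2 \<in> P"
    using in_P[of "w*y^2" "-2*w*y^2 + 2*x*y" "z*x + z*y" 0]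
    by (simp add: algebra_simps eval_nat_numeral)
  have H: "E^2 + (-z*w*y)^2 \<in> P"
    using in_P[of 0 E 0 "-z*w*y"] by (simp add: E_def algebra_simps eval_nat_numeral)
  have K: "(2*(x^2 + w*y^2))^2 + (w*x*y)^2 \<in> P"
    using in_P[of "w*x*y" "2*(x^2 + w*y^2)" 0 0] by (simp add: algebra_simps eval_nat_numeral)
  \<comment> \<open>Polarization: \<open>2 (\<alpha> \<cdot> \<beta>) = \<bar>\<alpha> + \<beta>\<bar>\<^sup>2 - \<bar>\<alpha>\<bar>\<^sup>2 - \<bar>\<beta>\<bar>\<^sup>2\<close>.\<close>
  have "2 * (x*y*E) = ((z*x + z*y)^2 + (-2*w*y^2 + 2*x*y)^2 + (w*y^2)^2) -
      1 * ((z*x)^2 + (-2*w*y^2)^2) - 1 * ((z*y)^2 + (2*x*y)^2 + (w*y^2)^2)"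
    unfolding E_def by Groebner_Basis.algebra
  then have "2 * (x*y*E) \<in> P"
    using diff[OF diff[OF AB A] B] by metis
  then consider "y \<in> P" | "x \<in> P" "y \<notin> P" | "E \<in> P" "y \<notin> P"
    using two D(5) by blast
  then show False
  proof cases
    case 1
    \<comment> \<open>Modulo \<open>y\<close>, the last two multipliers are \<open>z\<^sup>4\<close> and \<open>4 x\<^sup>4\<close>.\<close>
    have "z^4 = (E^2 + (-z*w*y)^2) - (y*(16*w^2*y^2 - 8*w*z^2 + z^2*w^2)) * y"
      unfolding E_def by Groebner_Basis.algebra
    then have z: "z \<in> P"
      using diff[OF H 1] power by metis
    have "(2 * x^2)^2 = ((2*(x^2 + w*y^2))^2 + (w*x*y)^2) - (y*(8*x^2*w + 4*w^2*y^2 + w^2*x^2)) * y"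
      by Groebner_Basis.algebra
    then have "x \<in> P"
      using diff[OF K 1] power two D(5) by metis
    then show False
      using prime_eq_origin_ideal[OF P] assms(2) 1 z by (simp add: x_y_z_w_def)
  next
    case 2
    \<comment> \<open>Modulo \<open>x\<close>, first \<open>w\<close> and then \<open>z\<close> lie in \<open>P\<close>, although \<open>w + z = 1\<close>.\<close>
    have "(2 * (w * y^2))^2 = ((2*(x^2 + w*y^2))^2 + (w*x*y)^2) - (x*(8*w*y^2 + 4*x^2 + w^2*y^2)) * x"
      by Groebner_Basis.algebra
    then have w: "w \<in> P"
      using diff[OF K 2(1)] 2 power two D(5) by metis
    have "(z*y)^2 = ((z*y)^2 + (2*x*y)^2 + (w*y^2)^2) - (4*x*y^2) * x - (w*y^4) * w"
      by Groebner_Basis.algebra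
    then have z: "z \<in> P"
      using diff[OF diff[OF B 2(1)] w] 2 power D(5) by metis
    show False
      using D(2,3) w z by (metis x_y_z_w_def(3,4) diff_add_cancel)
  next
    case 3
    \<comment> \<open>Either of \<open>z\<close> and \<open>w\<close> forces the other one into \<open>P\<close>, since \<open>E = z\<^sup>2 - 4 w y\<^sup>2\<close>.\<close>
    have "(z*w*y)^2 = (E^2 + (-z*w*y)^2) - E * E"
      by Groebner_Basis.algebra
    then consider "z \<in> P" | "w \<in> P"
      using diff[OF H 3(1)] 3 power D(5) by metis
    then show False
    proof cases
      case z: 1
      have "w * (2*y)^2 = (-1) * (E - z * z)"
        unfolding E_def by Groebner_Basis.algebra
      then have "w \<in> P"
        using D(4)[OF diff[OF 3(1) z]] 3 power two D(5) by metis
      then show False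
        using D(2,3) z by (metis x_y_z_w_def(3,4) diff_add_cancel)
    next
      case w: 2
      have "z^2 = E - (-4*y^2) * w"
        unfolding E_def by Groebner_Basis.algebra
      then have "z \<in> P"
        using diff[OF 3(1) w] power by metis
      then show False
        using D(2,3) w by (metis x_y_z_w_def(3,4) diff_add_cancel)
    qed
  qed
qed

section \<open>Leading forms along lines\<close>

text \<open>
  The substitution of \<open>c t\<close> for the outermost variable, after a map \<open>\<phi>\<close> that has already substituted
  for the inner ones. It is applied once for \<open>y\<close> and once for \<open>z\<close>.
\<close>

lemma coeff_poly_map_poly:
  fixes \<phi> :: "'a::zero \<Rightarrow> real poly"
  assumes "\<phi> 0 = 0"
  shows "Polynomial.coeff (Polynomial.poly (map_poly \<phi> g) [:0, c:]) n =
    (\<Sum>k\<le>n. c^k * Polynomial.coeff (\<phi> (Polynomial.coeff g k)) (n - k))"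
proof (induction g arbitrary: n)
  case (pCons a g)
  show ?case
  proof (cases n)
    case (Suc m)
    show ?thesis
      unfolding Suc sum.atMost_Suc_shift
      using pCons by (simp add: map_poly_pCons assms sum_distrib_left mult.assoc)
  qed (simp add: map_poly_pCons assms)
qed (simp add: assms)

text \<open>
  The restrictions of a polynomial to the line through the origin in a given direction, as polynomials
  in the parameter of the line; their coefficients are the homogeneous parts at that direction.
\<close>

definition line2 :: "real Polynomial.poly Polynomial.poly \<Rightarrow> real \<Rightarrow> real \<Rightarrow> real Polynomial.poly" where
  "line2 g a b = Polynomial.poly (map_poly (\<lambda>p. pcompose p [:0, a:]) g) [:0, b:]"

definition line3 :: "poly3 \<Rightarrow> real \<Rightarrow> real \<Rightarrow> real \<Rightarrow> real Polynomial.poly" where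
  "line3 g a b c = Polynomial.poly (map_poly (\<lambda>p. line2 p a b) g) [:0, c:]"

lemma line2_0 [simp]: "line2 0 a b = 0"
  by (simp add: line2_def)

lemma poly_line2:
  "Polynomial.poly (line2 g a b) t = Polynomial.poly (Polynomial.poly g [:b * t:]) (a * t)"
  by (induction g) (simp_all add: line2_def map_poly_pCons poly_pcompose mult_ac)

lemma poly_line3: "Polynomial.poly (line3 g a b c) t = eval3 g (a*t) (b*t) (c*t)"
  by (induction g) (simp_all add: line3_def map_poly_pCons eval3_def poly_line2 mult_ac)

lemma coeff_line2:
  "Polynomial.coeff (line2 g a b) n =
    (\<Sum>j\<le>n. b^j * (a^(n - j) * Polynomial.coeff (Polynomial.coeff g j) (n - j)))"
  by (simp add: line2_def coeff_poly_map_poly coeff_pcompose_linear)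

lemma coeff_line3:
  "Polynomial.coeff (line3 g a b c) n =
    (\<Sum>k\<le>n. c^k * Polynomial.coeff (line2 (Polynomial.coeff g k) a b) (n - k))"
  by (simp add: line3_def coeff_poly_map_poly)

lemma poly_nonneg_at_0:
  fixes p :: "real Polynomial.poly"
  assumes "\<And>t. t \<noteq> 0 \<Longrightarrow> Polynomial.poly p t \<ge> 0"
  shows "Polynomial.poly p 0 \<ge> 0"
proof -
  have "(Polynomial.poly p \<longlongrightarrow> Polynomial.poly p 0) (at 0)"
    by (intro tendsto_intros)
  then show ?thesis
    by (rule tendsto_lowerbound) (auto simp: eventually_at_filter assms)
qed

text \<open>
  By induction on \<open>n\<close>, the bound forces \<open>t^n\<close> to divide \<open>q\<close>; dividing it out leaves a bound between
  polynomials, which extends to \<open>t = 0\<close> by continuity and so controls the coefficient of \<open>t^n\<close>.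
\<close>

lemma coeff_zero_if_square_bound:
  fixes q r :: "real Polynomial.poly"
  assumes "\<And>t. (Polynomial.poly q t)^2 \<le> t^(2*n) * Polynomial.poly r t"
  shows "(\<forall>m<n. Polynomial.coeff q m = 0) \<and> (Polynomial.coeff q n)^2 \<le> Polynomial.poly r 0"
  using assms
proof (induction n arbitrary: q)
  case 0
  show ?case using 0[of 0] by (simp add: poly_0_coeff_0)
next
  case (Suc n)
  obtain a q' where q: "q = pCons a q'" by (cases q)
  have a: "a = 0"
    using Suc.prems[of 0] by (simp add: q)
  have "(Polynomial.poly q' t)^2 \<le> t^(2*n) * Polynomial.poly r t" for t
  proof -
    define d where "d = Polynomial.monom 1 (2*n) * r - q'^2"
    have d: "Polynomial.poly d t = t^(2*n) * Polynomial.poly r t - (Polynomial.poly q' t)^2" for t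
      by (simp add: d_def poly_monom)
    have "Polynomial.poly d t \<ge> 0" if "t \<noteq> 0" for t
    proof -
      have "t^2 * Polynomial.poly d t \<ge> 0"
        using Suc.prems[of t] by (simp add: q a d algebra_simps power2_eq_square)
      then show ?thesis
        using that by (simp add: zero_le_mult_iff)
    qed
    then have "Polynomial.poly d t \<ge> 0"
      using poly_nonneg_at_0[of d] by (cases "t = 0") auto
    then show ?thesis
      by (simp add: d)
  qed
  from Suc.IH[OF this] show ?case
    by (auto simp: q a coeff_pCons split: nat.splits)
qed

section \<open>The obstruction at the origin\<close>

text \<open>
  The hypothesis holds for each summand \<open>g\<^sup>2\<close> of a representation of \<open>h\<^sup>2 f\<close> as a sum of squares.
\<close>

context
  fixes g h :: poly3
  assumes bound: "\<And>a b c. (eval3 g a b c)^2 \<le> (eval3 h a b c)^2 * bad_form a b c (1 - c)"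
begin

abbreviation cf :: "nat \<Rightarrow> nat \<Rightarrow> nat \<Rightarrow> real" where
  "cf i j k \<equiv> Polynomial.coeff (Polynomial.coeff (Polynomial.coeff g k) j) i"

lemma line3_bound:
  "(\<forall>m<4. Polynomial.coeff (line3 g a b c) m = 0) \<and>
   (Polynomial.coeff (line3 g a b c) 4)^2 \<le> (eval3 h 0 0 0)^2 * bad_form a b c 1"
proof -
  define r where "r = (line3 h a b c)^2 * bad_form [:a:] [:b:] [:c:] [:1, -c:]"
  have r: "Polynomial.poly r t = (eval3 h (a*t) (b*t) (c*t))^2 * bad_form a b c (1 - c*t)" for t
    by (simp add: r_def poly_line3 poly_bad_form mult.commute)
  have "(Polynomial.poly (line3 g a b c) t)^2 \<le> t^(2*4) * Polynomial.poly r t" for t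
  proof -
    have "bad_form (a*t) (b*t) (c*t) (1 - c*t) = t^8 * bad_form a b c (1 - c*t)"
      using bad_form_homogeneous[of t a b c "1 - c*t"] by (simp add: mult.commute)
    then show ?thesis
      using bound[of "a*t" "b*t" "c*t"] by (simp add: r poly_line3 mult_ac)
  qed
  from coeff_zero_if_square_bound[OF this] show ?thesis
    by (simp add: r)
qed

lemma leading_form:
  "Polynomial.coeff (line3 g a b c) 4 =
    cf 4 0 0 * a^4 + cf 3 1 0 * a^3*b + cf 2 2 0 * a^2*b^2 + cf 1 3 0 * a*b^3 + cf 0 4 0 * b^4 +
    (cf 3 0 1 * a^3 + cf 2 1 1 * a^2*b + cf 1 2 1 * a*b^2 + cf 0 3 1 * b^3) * c +
    (cf 2 0 2 * a^2 + cf 1 1 2 * a*b + cf 0 2 2 * b^2) * c^2 +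
    (cf 1 0 3 * a + cf 0 1 3 * b) * c^3 + cf 0 0 4 * c^4"
  by (simp add: coeff_line3 coeff_line2 eval_nat_numeral algebra_simps)

lemma cubic_coeff_0: "cf 2 0 1 = 0"
proof -
  have "cf 3 0 0 * a^3 + cf 2 0 1 * a^2 * c + cf 1 0 2 * a * c^2 + cf 0 0 3 * c^3 = 0" for a c
    using line3_bound[of a 0 c, THEN conjunct1, rule_format, of 3]
    by (simp add: coeff_line3 coeff_line2 eval_nat_numeral algebra_simps)
  from this[of 1 1] this[of 1 "-1"] this[of 1 0] this[of 0 1] show ?thesis
    by simp
qed

text \<open>
  At height \<open>c > 1\<close> put \<open>s = \<surd>(c - 1)\<close>. In the directions \<open>(\<plusminus>s, 1)\<close> one of the two factors of
  the norm loses its quadratic term in \<open>t\<close>, so \<open>f\<close> vanishes to order 6 there and \<open>g\<close> to order 3.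
  Hence the quadratic part \<open>q\<^sub>2\<^sub>0 x\<^sup>2 + q\<^sub>1\<^sub>1 x y + q\<^sub>0\<^sub>2 y\<^sup>2\<close> of \<open>g\<close> is zero at both directions, which gives
  \<open>q\<^sub>0\<^sub>2 = (1 - z) q\<^sub>2\<^sub>0\<close> for all real \<open>z > 1\<close>, and therefore as polynomials in \<open>z\<close>.
\<close>

lemma coeffs_along_axis: "cf 0 2 2 = cf 2 0 2 - cf 2 0 1"
proof -
  define q where "q = (\<lambda>i j. map_poly (\<lambda>p. Polynomial.coeff (Polynomial.coeff p j) i) g)"
  have poly_q: "Polynomial.poly (map_poly (\<lambda>p. Polynomial.coeff (Polynomial.coeff p j) i) G) c =
      Polynomial.coeff (Polynomial.coeff (Polynomial.poly G [:[:c:]:]) j) i" for i j c G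
    by (induction G) (simp_all add: map_poly_pCons)
  have "Polynomial.poly (q 0 2 - [:1, -1:] * q 2 0) c = 0" if c: "c > 1" for c
  proof -
    define s where "s = sqrt (c - 1)"
    have s: "1 - c = -(s^2)"
      using c by (simp add: s_def)
    let ?G = "Polynomial.poly g [:[:c:]:]" and ?H = "Polynomial.poly h [:[:c:]:]"
    have zero: "Polynomial.coeff (line2 ?G a 1) 2 = 0" if a: "a = s \<or> a = -s" for a
    proof -
      define r where "r = (line2 ?H a 1)^2 * ([:s^6:] * [:4*s^2*c^2, 0, 16*s^4 + s^6:])"
      have "(Polynomial.poly (line2 ?G a 1) t)^2 \<le> t^(2*3) * Polynomial.poly r t" for t
      proof -
        have "bad_form (a*t) t c (-(s^2)) = t^6 * (s^6 * (4*s^2*c^2 + (16*s^4 + s^6)*t^2))"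
          using a
        proof
          assume "a = s"
          show ?thesis unfolding bad_form_conjugates \<open>a = s\<close>
            by (simp add: algebra_simps eval_nat_numeral)
        next
          assume "a = -s"
          show ?thesis unfolding bad_form_conjugates \<open>a = -s\<close>
            by (simp add: algebra_simps eval_nat_numeral)
        qed
        then show ?thesis
          using bound[of "a*t" t c]
          by (simp add: r_def poly_line2 eval3_def s algebra_simps power2_eq_square)
      qed
      from coeff_zero_if_square_bound[OF this] show ?thesis
        by simp
    qed
    have "Polynomial.poly (q 0 2) c + a * Polynomial.poly (q 1 1) c + a^2 * Polynomial.poly (q 2 0) c = 0"
      if "a = s \<or> a = -s" for a
      using zero[OF that]
      by (simp add: q_def poly_q coeff_line2 eval_nat_numeral algebra_simps)
    from this[of s] this[of "-s"]
    have "s^2 * Polynomial.poly (q 2 0) c + Polynomial.poly (q 0 2) c = 0"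
      unfolding power2_minus mult_minus_left by linarith
    moreover have "s^2 = c - 1"
      using s by simp
    ultimately show ?thesis
      by (simp add: algebra_simps)
  qed
  then have "{1<..} \<subseteq> {c. Polynomial.poly (q 0 2 - [:1, -1:] * q 2 0) c = 0}"
    by auto
  then have "q 0 2 - [:1, -1:] * q 2 0 = 0"
    using poly_roots_finite finite_subset infinite_Ioi by blast
  then have "Polynomial.coeff (q 0 2) 2 = Polynomial.coeff ([:1, -1:] * q 2 0) 2"
    by simp
  then show ?thesis
    by (simp add: q_def coeff_map_poly eval_nat_numeral)
qed

text \<open>
  The quartic form \<open>H\<close> of \<open>g\<close> is bounded by the square root of the leading form of \<open>f\<close>. That form
  equals \<open>x\<^sup>4 z\<^sup>4\<close> on the plane \<open>y = 0\<close>, so there \<open>H\<close> is \<open>\<lambda> x\<^sup>2 z\<^sup>2\<close>. It vanishes at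
  \<open>(0, 1, \<plusminus>\<surd>3)\<close> and to order 10 in \<open>y\<close> along the curve
  \<open>(1, y, \<plusminus>(2 y + y\<^sup>3/4))\<close>. With \<open>\<mu>\<close> and \<open>\<rho>\<close> the coefficients of \<open>y\<^sup>2 z\<^sup>2\<close> and \<open>y\<^sup>4\<close> in
  \<open>H\<close>, the former gives \<open>3 \<mu> + \<rho> = 0\<close> and the latter \<open>\<lambda> + 4 \<mu> + \<rho> = 0\<close>, hence
  \<open>\<lambda> = -\<mu>\<close>; along the axis \<open>\<lambda> = \<mu>\<close> was found.
\<close>

lemma line3_diagonal_zero:
  assumes "m < 5"
  shows "Polynomial.coeff (line3 g 1 0 1) m = 0"
proof -
  define K where "K = (eval3 h 0 0 0)^2"
  define H where "H = (\<lambda>a b c. Polynomial.coeff (line3 g a b c) 4)"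
  have H_bound: "(H a b c)^2 \<le> K * bad_form a b c 1" for a b c
    using line3_bound by (simp add: H_def K_def)
  have "(Polynomial.poly [:cf 4 0 0, cf 3 0 1, cf 2 0 2, cf 1 0 3, cf 0 0 4:] c)^2 \<le>
      c^(2*2) * Polynomial.poly [:K:] c" for c
  proof -
    have "H 1 0 c = Polynomial.poly [:cf 4 0 0, cf 3 0 1, cf 2 0 2, cf 1 0 3, cf 0 0 4:] c"
      unfolding H_def leading_form by (simp add: algebra_simps eval_nat_numeral)
    then show ?thesis
      using H_bound[of 1 0 c] by (simp add: bad_form_def mult.commute)
  qed
  from coeff_zero_if_square_bound[OF this]
  have x: "cf 4 0 0 = 0" "cf 3 0 1 = 0"
    by (auto simp: eval_nat_numeral All_less_Suc)
  have "(Polynomial.poly [:cf 0 0 4, cf 1 0 3, cf 2 0 2, cf 3 0 1, cf 4 0 0:] a)^2 \<le>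
      a^(2*2) * Polynomial.poly [:K:] a" for a
  proof -
    have "H a 0 1 = Polynomial.poly [:cf 0 0 4, cf 1 0 3, cf 2 0 2, cf 3 0 1, cf 4 0 0:] a"
      unfolding H_def leading_form by (simp add: algebra_simps eval_nat_numeral)
    then show ?thesis
      using H_bound[of a 0 1] by (simp add: bad_form_def mult.commute)
  qed
  from coeff_zero_if_square_bound[OF this]
  have z: "cf 0 0 4 = 0" "cf 1 0 3 = 0"
    by (auto simp: eval_nat_numeral All_less_Suc)
  have "H 0 1 (sqrt 3) = 0" "H 0 1 (- sqrt 3) = 0"
    using H_bound[of 0 1 "sqrt 3"] H_bound[of 0 1 "- sqrt 3"] by (simp_all add: bad_form_def)
  then have point: "3 * cf 0 2 2 + cf 0 4 0 = 0"
    by (simp add: H_def leading_form z)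
  \<comment> \<open>\<open>Z\<close> is \<open>z\<^sup>2\<close> along the curve, and \<open>q\<close> is the part of \<open>H\<close> that is even in \<open>z\<close>. On the curve
     \<open>z\<^sup>2 - 4 y\<^sup>2 = y\<^sup>4 + y\<^sup>6/16\<close>, chosen so that the first square of the leading form has order 12.\<close>
  define Z :: "real Polynomial.poly" where "Z = [:0, 0, 4, 0, 1, 0, 1/16:]"
  define q where "q = [:cf 4 0 0, cf 3 1 0, cf 2 2 0, cf 1 3 0, cf 0 4 0:] +
    [:cf 2 0 2, cf 1 1 2, cf 0 2 2:] * Z"
  define r where "r = [:K:] * ([:0, 1:]^2 * [:15/16, 0, 1/16:]^2 + [:4:] * [:1, 0, 1/16:]^2)"
  have "(Polynomial.poly q y)^2 \<le> y^(2*5) * Polynomial.poly r y" for y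
  proof -
    define u where "u = 2*y + y^3/4"
    have Z: "Polynomial.poly Z y = u^2"
      by (simp add: Z_def u_def power2_eq_square power3_eq_cube algebra_simps)
    have "Polynomial.poly q y = (H 1 y u + H 1 y (-u)) / 2"
      unfolding q_def H_def leading_form z by (simp add: Z algebra_simps eval_nat_numeral)
    moreover have "((p + p') / 2)^2 \<le> (p^2 + p'^2) / 2" for p p' :: real
      using sum_squares_bound[of p p'] by (simp add: power2_eq_square field_simps)
    ultimately have "(Polynomial.poly q y)^2 \<le> ((H 1 y u)^2 + (H 1 y (-u))^2) / 2"
      by (simp only:)
    also have "\<dots> \<le> K * bad_form 1 y u 1"
      using H_bound[of 1 y u] H_bound[of 1 y "-u"] by (simp add: bad_form_def)
    also have "bad_form 1 y u 1 =
        y^10 * (y^2 * (15/16 + y^2/16)^2 + 4 * (1 + y^2/16)^2)"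
      unfolding bad_form_def u_def by (simp add: field_simps eval_nat_numeral)
    finally show ?thesis
      by (simp add: r_def power2_eq_square algebra_simps)
  qed
  from coeff_zero_if_square_bound[OF this]
  have "Polynomial.coeff q 4 = 0" by simp
  then have curve: "cf 2 0 2 + 4 * cf 0 2 2 + cf 0 4 0 = 0"
    by (simp add: q_def Z_def eval_nat_numeral)
  have "cf 2 0 2 = 0"
    using curve point coeffs_along_axis cubic_coeff_0 by simp
  then have "H 1 0 1 = 0"
    using x z by (simp add: H_def leading_form)
  then show ?thesis
    using assms line3_bound[of 1 0 1] by (cases "m = 4") (auto simp: H_def)
qed

end

lemma bad_poly_not_sos_at_origin:
  "\<not> sum_of_squares_in (localization origin_ideal) (Fraction_Field.Fract bad_poly 1)"
proof
  assume "sum_of_squares_in (localization origin_ideal) (Fraction_Field.Fract bad_poly 1)"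
  then obtain h gs where "h \<notin> origin_ideal" and eq: "h^2 * bad_poly = (\<Sum>g\<leftarrow>gs. g^2)"
    by (rule sum_of_squares_in_localizationD) (auto simp: origin_ideal_eq)
  then have h: "eval3 h 0 0 0 \<noteq> 0"
    by (simp add: origin_ideal_eq)
  have eval_sum: "eval3 (\<Sum>g\<leftarrow>us. g^2) a b c = (\<Sum>g\<leftarrow>us. (eval3 g a b c)^2)" for us a b c
    by (induction us) auto
  have eval: "(\<Sum>g\<leftarrow>gs. (eval3 g a b c)^2) = (eval3 h a b c)^2 * bad_form a b c (1 - c)" for a b c
    using arg_cong[OF eq, of "\<lambda>f. eval3 f a b c"] by (simp add: eval_sum eval3_bad_poly)
  have dvd: "Polynomial.monom 1 5 dvd line3 g 1 0 1" if "g \<in> set gs" for g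
  proof -
    have "(eval3 g a b c)^2 \<le> (eval3 h a b c)^2 * bad_form a b c (1 - c)" for a b c
      unfolding eval[symmetric] using that by (intro member_le_sum_list) auto
    then show ?thesis
      using line3_diagonal_zero[of g h] by (auto simp: monom_1_dvd_iff')
  qed
  have "\<exists>s. \<forall>t. (\<Sum>g\<leftarrow>us. (eval3 g t 0 t)^2) = t^10 * Polynomial.poly s t"
    if "set us \<subseteq> set gs" for us
    using that
  proof (induction us)
    case (Cons g us)
    obtain s where s: "(\<Sum>g\<leftarrow>us. (eval3 g t 0 t)^2) = t^10 * Polynomial.poly s t" for t
      using Cons by auto
    have "Polynomial.monom 1 5 dvd line3 g 1 0 1"
      using dvd Cons.prems by simp
    then obtain u where "line3 g 1 0 1 = Polynomial.monom 1 5 * u"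
      by (rule dvdE)
    then have "eval3 g t 0 t = t^5 * Polynomial.poly u t" for t
      using poly_line3[of g 1 0 1 t] by (simp add: poly_monom)
    then show ?case
      by (intro exI[of _ "u^2 + s"]) (simp add: s power_mult_distrib algebra_simps)
  qed (intro exI[of _ 0], simp)
  then obtain s where s: "(\<Sum>g\<leftarrow>gs. (eval3 g t 0 t)^2) = t^10 * Polynomial.poly s t" for t
    by blast
  define d where "d = (line3 h 1 0 1)^2 - Polynomial.monom 1 2 * s"
  have "Polynomial.poly d t = 0" if "t \<noteq> 0" for t
  proof -
    have "t^8 * (t^2 * Polynomial.poly s t) = t^8 * (eval3 h t 0 t)^2"
      using s[of t] eval[of t 0 t] by (simp add: bad_form_def algebra_simps eval_nat_numeral)
    then have "t^2 * Polynomial.poly s t = (eval3 h t 0 t)^2"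
      using that by (simp only: mult_cancel_left) simp
    then show ?thesis
      using poly_line3[of h 1 0 1 t] by (simp add: d_def poly_monom)
  qed
  then have "Polynomial.poly d 0 = 0"
    using poly_nonneg_at_0[of d] poly_nonneg_at_0[of "-d"] by force
  then show False
    using h poly_line3[of h 1 0 1 0] by (simp add: d_def poly_monom)
qed

theorem theorem3p11:
  shows "\<exists>f :: poly3.
    positive_semidefinite f \<and>
    sum_of_squares_in UNIV (fps3_of_poly3 f) \<and>
    (\<forall>P. primeideal P poly3_ring \<and> P \<noteq> origin_ideal \<longrightarrow>
       sum_of_squares_in (localization P) (Fraction_Field.Fract f 1)) \<and>
    \<not> sum_of_squares_in (localization origin_ideal) (Fraction_Field.Fract f 1)"
proof (intro exI[of _ bad_poly] conjI allI impI)
  show "positive_semidefinite bad_poly"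
    by (simp add: positive_semidefinite_def eval3_bad_poly bad_form_nonneg)
qed (use bad_poly_sos_power_series bad_poly_sos_localization bad_poly_not_sos_at_origin in auto)

end
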